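(* Let $E=(N,C,A,k)$ be an election with $m=|C|$ candidates, let $r=m-k$, and let $W$ be the committee returned by Reverse Sequential PAV on $E$. Then $$\operatorname{PAV}(W)\ge \frac{k}{m-1}\operatorname{OPT}_k=\frac{k}{k+r-1}\operatorname{OPT}_k.$$
   Context: An election is a tuple $E=(N,C,A,k)$, where $N=\{1,\ldots,n\}$ is a set of voters, $C$ is a set of $m$ candidates, $A=(A_i)_{i\in N}$ is a profile of approval ballots $A_i\subseteq C$, and $k$ is the desired committee size. It is assumed that $1\le k<m$ and that $A_i\ne\emptyset$ for at least one voter $i$. A committee is a set $W\subseteq C$ with $|W|=k$. For an integer $t\ge 0$, $H(t)=\sum_{j=1}^{t}1/j$ (so $H(0)=0$). For $S\subseteq C$, $\operatorname{PAV}(S)=\sum_{i\in N}H(|A_i\cap S|)$, and for $c\in S$ the marginal loss is $\Delta_S(c)=\operatorname{PAV}(S)-\operatorname{PAV}(S\setminus\{c\})$. $\operatorname{OPT}_k$ is the maximum of $\operatorname{PAV}(W')$ over all committees $W'\subseteq C$ with $|W'|=k$. Reverse Sequential PAV: let $C_m=C$; for $s=m,m-1,\ldots,k+1$ pick $c_s\in\arg\min_{c\in C_s}\Delta_{C_s}(c)$ and set $C_{s-1}=C_s\setminus\{c_s\}$; return $W=C_k$. Ties are resolved using a fixed priority (linear) order on candidates. *)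

theory Defs
  imports "HOL-Analysis.Analysis"
begin

text \<open>
  An election has voters \<open>{1..n}\<close>, candidates \<open>C\<close>, ballots \<open>A i\<close> for voters \<open>i\<close>, and committee
  size \<open>k\<close>. Values of \<open>A\<close> outside \<open>{1..n}\<close> are irrelevant.
\<close>

locale election =
  fixes n :: nat and C :: "'c set" and A :: "nat \<Rightarrow> 'c set" and k :: nat
  assumes finite_candidates: "finite C"
    and ballots: "\<forall>i\<in>{1..n}. A i \<subseteq> C"
    and some_nonempty_ballot: "\<exists>i\<in>{1..n}. A i \<noteq> {}"
    and k_pos: "1 \<le> k"
    and k_less: "k < card C"

definition committees :: "'c set \<Rightarrow> nat \<Rightarrow> 'c set set" where
  "committees C k = {W. W \<subseteq> C \<and> card W = k}"

definition PAV :: "nat \<Rightarrow> (nat \<Rightarrow> 'c set) \<Rightarrow> 'c set \<Rightarrow> real" where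
  "PAV n A S = (\<Sum>i\<in>{1..n}. harm (card (A i \<inter> S)))"

definition OPT :: "nat \<Rightarrow> 'c set \<Rightarrow> (nat \<Rightarrow> 'c set) \<Rightarrow> nat \<Rightarrow> real" where
  "OPT n C A k = Max (PAV n A ` committees C k)"

definition marginal_loss :: "nat \<Rightarrow> (nat \<Rightarrow> 'c set) \<Rightarrow> 'c set \<Rightarrow> 'c \<Rightarrow> real" where
  "marginal_loss n A S c = PAV n A S - PAV n A (S - {c})"

definition min_loss_candidates :: "nat \<Rightarrow> (nat \<Rightarrow> 'c set) \<Rightarrow> 'c set \<Rightarrow> 'c set" where
  "min_loss_candidates n A S = {c. is_arg_min (marginal_loss n A S) (\<lambda>c. c \<in> S) c}"

text \<open>
  Ties are broken by a linear order \<open>R\<close> on the candidates: the \<open>R\<close>-first minimizer is removed.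
  Results quantified over all \<open>R\<close> cover the opposite convention too, via the converse order.
\<close>

definition removal_choice :: "('c \<times> 'c) set \<Rightarrow> nat \<Rightarrow> (nat \<Rightarrow> 'c set) \<Rightarrow> 'c set \<Rightarrow> 'c" where
  "removal_choice R n A S =
    (THE c. c \<in> min_loss_candidates n A S \<and> (\<forall>d\<in>min_loss_candidates n A S. (c, d) \<in> R))"

text \<open>\<open>remaining R n C A j\<close> is the candidate set after \<open>j\<close> removals, i.e. \<open>C\<^sub>s\<close> for \<open>s = card C - j\<close>.\<close>

primrec remaining ::
  "('c \<times> 'c) set \<Rightarrow> nat \<Rightarrow> 'c set \<Rightarrow> (nat \<Rightarrow> 'c set) \<Rightarrow> nat \<Rightarrow> 'c set" where
  "remaining R n C A 0 = C"
| "remaining R n C A (Suc j) =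
    remaining R n C A j - {removal_choice R n A (remaining R n C A j)}"

definition reverse_seq_PAV ::
  "('c \<times> 'c) set \<Rightarrow> nat \<Rightarrow> 'c set \<Rightarrow> (nat \<Rightarrow> 'c set) \<Rightarrow> nat \<Rightarrow> 'c set" where
  "reverse_seq_PAV R n C A k = remaining R n C A (card C - k)"

lemma finite_linear_order_first:
  assumes "linear_order_on C R" "finite M" "M \<noteq> {}" "M \<subseteq> C"
  shows "\<exists>c\<in>M. \<forall>d\<in>M. (c, d) \<in> R"
  using assms(2,3,4)
proof (induction M rule: finite_ne_induct)
  case (singleton x)
  then show ?case
    using assms(1) by (auto simp: order_on_defs refl_on_def)
next
  case (insert x F)
  then obtain c where c: "c \<in> F" "\<forall>d\<in>F. (c, d) \<in> R" by auto
  have refl: "(x, x) \<in> R"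
    using assms(1) insert.prems by (auto simp: order_on_defs refl_on_def)
  have tr: "trans R" and tot: "total_on C R"
    using assms(1) by (auto simp: order_on_defs)
  have "(c, x) \<in> R \<or> (x, c) \<in> R"
    using tot insert.prems insert.hyps(3) c(1) unfolding total_on_def by (metis insert_subset subsetD)
  then show ?case
  proof
    assume "(c, x) \<in> R"
    then show ?thesis using c by auto
  next
    assume "(x, c) \<in> R"
    then have "\<forall>d\<in>insert x F. (x, d) \<in> R"
      using c(2) refl transD[OF tr] by blast
    then show ?thesis by blast
  qed
qed

lemma removal_choice_in:
  assumes R: "linear_order_on C R" and S: "finite S" "S \<noteq> {}" "S \<subseteq> C"
  shows "removal_choice R n A S \<in> min_loss_candidates n A S"
    and "\<forall>d\<in>min_loss_candidates n A S. (removal_choice R n A S, d) \<in> R"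
proof -
  let ?M = "min_loss_candidates n A S"
  have sub: "?M \<subseteq> S"
    by (auto simp: min_loss_candidates_def is_arg_min_def)
  have "?M \<noteq> {}"
    using ex_is_arg_min_if_finite[OF S(1,2), of "marginal_loss n A S"]
    by (auto simp: min_loss_candidates_def)
  then obtain c where c: "c \<in> ?M" "\<forall>d\<in>?M. (c, d) \<in> R"
    using finite_linear_order_first[OF R finite_subset[OF sub S(1)] _ subset_trans[OF sub S(3)]] by blast
  have "antisym R"
    using R by (simp add: order_on_defs)
  then have "\<exists>!c. c \<in> ?M \<and> (\<forall>d\<in>?M. (c, d) \<in> R)"
    using c by (auto dest: antisymD)
  from theI'[OF this] show "removal_choice R n A S \<in> ?M"
    and "\<forall>d\<in>?M. (removal_choice R n A S, d) \<in> R"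
    by (simp_all add: removal_choice_def)
qed

lemma reverse_seq_PAV_committee:
  assumes "election n C A k" "linear_order_on C R"
  shows "reverse_seq_PAV R n C A k \<in> committees C k"
proof -
  interpret election n C A k by fact
  have "remaining R n C A j \<subseteq> C \<and> card (remaining R n C A j) = card C - j"
    if "j \<le> card C" for j
    using that
  proof (induction j)
    case (Suc j)
    let ?S = "remaining R n C A j"
    have S: "?S \<subseteq> C" "card ?S = card C - j"
      using Suc by auto
    then have "finite ?S" "?S \<noteq> {}"
      using Suc.prems finite_candidates finite_subset by auto
    then have "removal_choice R n A ?S \<in> ?S"
      using removal_choice_in(1)[OF assms(2)] S(1)
      by (force simp: min_loss_candidates_def is_arg_min_def)
    then show ?case
      using S by (auto simp: card_Diff_singleton)
  qed simp
  from this[of "card C - k"] show ?thesis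
    using k_less by (simp add: reverse_seq_PAV_def committees_def)
qed

end

theory Submission
  imports Defs
begin

text \<open>
  The marginal losses of the members of \<open>S\<close> add up to the number of voters who approve some member
  of \<open>S\<close>, which is at most \<open>PAV S\<close>. Hence removing a candidate of minimal loss from \<open>S\<close> keeps at
  least the fraction \<open>1 - 1 / card S\<close> of the score. This telescopes to \<open>k / (m - 1)\<close> from the second
  removal on. The first removal is free: an optimal committee omits some candidate \<open>d\<close>, so
  its score is at most that of \<open>C - {d}\<close>, and the first removal is at least as good as removing \<open>d\<close>.
\<close>

lemma PAV_nonneg: "PAV n A S \<ge> 0"
  unfolding PAV_def by (intro sum_nonneg harm_nonneg)

lemma PAV_mono:
  assumes "finite T" "S \<subseteq> T"
  shows "PAV n A S \<le> PAV n A T"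
  unfolding PAV_def using assms by (intro sum_mono harm_mono card_mono) auto

text \<open>This is the contribution of one voter with ballot \<open>B\<close>. Deleting
  \<open>c\<close> costs the last harmonic term, \<open>1 / card (B \<inter> S)\<close>, if
  \<open>c\<close> is approved, and nothing otherwise.\<close>

lemma sum_harm_loss_le:
  fixes B S :: "'c set"
  assumes "finite S"
  shows "(\<Sum>c\<in>S. harm (card (B \<inter> S)) - harm (card (B \<inter> (S - {c})))) \<le> (harm (card (B \<inter> S)) :: real)"
proof -
  let ?b = "card (B \<inter> S)"
  have "harm ?b - harm (card (B \<inter> (S - {c}))) = (if c \<in> B then 1 / real ?b else 0)"
    if "c \<in> S" for c
  proof (cases "c \<in> B")
    case True
    have "B \<inter> (S - {c}) = B \<inter> S - {c}" by auto
    then have "?b = Suc (card (B \<inter> (S - {c})))"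
      using True that assms by (simp only:) (metis IntI card_Suc_Diff1 finite_Int)
    then show ?thesis
      using True by (simp add: harm_Suc inverse_eq_divide)
  next
    case False
    then have "B \<inter> (S - {c}) = B \<inter> S" by auto
    then show ?thesis using False by simp
  qed
  then have "(\<Sum>c\<in>S. harm ?b - harm (card (B \<inter> (S - {c}))))
      = (\<Sum>c\<in>S. if c \<in> B then 1 / real ?b else 0)"
    by (intro sum.cong) auto
  also have "\<dots> = (\<Sum>c\<in>B \<inter> S. 1 / real ?b)"
    using assms by (simp add: sum.inter_restrict[symmetric] Int_commute)
  also have "\<dots> \<le> harm ?b"
  \<comment> \<open>If \<open>?b\<close> is positive, \<open>?b\<close> copies of
    \<open>1 / ?b\<close> add up to 1, which is \<open>harm 1\<close>; otherwise both sides are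
    0.\<close>
  proof (cases "?b = 0")
    case False
    then have "harm 1 \<le> (harm ?b :: real)"
      by (intro harm_mono) simp
    with False show ?thesis by (simp add: harm_def)
  qed (simp add: harm_nonneg)
  finally show ?thesis .
qed

lemma sum_marginal_loss_le_PAV:
  assumes "finite S"
  shows "(\<Sum>c\<in>S. marginal_loss n A S c) \<le> PAV n A S"
proof -
  have "(\<Sum>c\<in>S. marginal_loss n A S c)
      = (\<Sum>i\<in>{1..n}. \<Sum>c\<in>S. harm (card (A i \<inter> S)) - harm (card (A i \<inter> (S - {c}))))"
    unfolding marginal_loss_def PAV_def sum_subtractf[symmetric] by (rule sum.swap)
  also have "\<dots> \<le> PAV n A S"
    unfolding PAV_def by (intro sum_mono sum_harm_loss_le assms)
  finally show ?thesis .
qed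

lemma min_loss_candidates_iff:
  "c \<in> min_loss_candidates n A S \<longleftrightarrow>
    c \<in> S \<and> (\<forall>d\<in>S. marginal_loss n A S c \<le> marginal_loss n A S d)"
  by (auto simp: min_loss_candidates_def is_arg_min_linorder)

text \<open>A minimum is at most the average, so the smallest loss is at most
  \<open>PAV n A S / card S\<close>. The bound is kept multiplied out to avoid division.\<close>

lemma PAV_remove_min_loss_ge:
  assumes "finite S" "c \<in> min_loss_candidates n A S"
  shows "real (card S) * PAV n A (S - {c}) \<ge> (real (card S) - 1) * PAV n A S"
proof -
  have "real (card S) * marginal_loss n A S c \<le> (\<Sum>d\<in>S. marginal_loss n A S d)"
    using assms(2) by (intro sum_bounded_below) (simp add: min_loss_candidates_iff)
  also have "\<dots> \<le> PAV n A S"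
    by (rule sum_marginal_loss_le_PAV[OF assms(1)])
  finally show ?thesis
    by (simp add: marginal_loss_def algebra_simps)
qed

text \<open>This serves the first removal, with \<open>S = C\<close>. Later on, \<open>T\<close>
  need not lie inside the remaining set.\<close>

lemma PAV_remove_min_loss_ge_subset:
  assumes "finite S" "c \<in> min_loss_candidates n A S" "T \<subset> S"
  shows "PAV n A (S - {c}) \<ge> PAV n A T"
proof -
  obtain d where d: "d \<in> S" "d \<notin> T" using assms(3) by blast
  have "PAV n A T \<le> PAV n A (S - {d})"
    using assms d by (intro PAV_mono) auto
  also have "\<dots> \<le> PAV n A (S - {c})"
    using assms(2) d(1) by (force simp: min_loss_candidates_iff marginal_loss_def)
  finally show ?thesis .
qed

text \<open>As long as \<open>j < card C\<close>, the remaining set is nonempty, so the choice is a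
  genuine minimizer and each removal lowers the cardinality by one.\<close>

lemma remaining_step:
  assumes "finite C" "linear_order_on C R" "j < card C"
  shows "remaining R n C A j \<subseteq> C"
    and "card (remaining R n C A j) = card C - j"
    and "removal_choice R n A (remaining R n C A j) \<in> min_loss_candidates n A (remaining R n C A j)"
proof -
  let ?S = "remaining R n C A"
  have choice: "removal_choice R n A (?S i) \<in> min_loss_candidates n A (?S i)"
    if "?S i \<subseteq> C" "card (?S i) = card C - i" "i < card C" for i
    using that assms(1) finite_subset
    by (intro removal_choice_in(1)[OF assms(2)]) auto
  have *: "?S j \<subseteq> C \<and> card (?S j) = card C - j"
    using assms(3)
  proof (induction j)
    case (Suc j)
    then have S: "?S j \<subseteq> C" "card (?S j) = card C - j" by auto
    then have "removal_choice R n A (?S j) \<in> ?S j"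
      using choice Suc.prems by (simp add: min_loss_candidates_iff)
    then show ?case
      using S by (auto simp: card_Diff_singleton)
  qed simp
  then show "?S j \<subseteq> C" "card (?S j) = card C - j" by auto
  with choice assms(3) show "removal_choice R n A (?S j) \<in> min_loss_candidates n A (?S j)"
    by blast
qed

text \<open>The ratios \<open>(s - 1) / s\<close> telescope from \<open>s = card C - 1\<close>
  downwards. The induction starts at one removal, since the first one loses nothing against
  \<open>T\<close>.\<close>

lemma PAV_remaining_ge:
  assumes "finite C" "linear_order_on C R" "Suc j < card C" "T \<subset> C"
  shows "(real (card C) - 1) * PAV n A (remaining R n C A (Suc j))
    \<ge> (real (card C) - real (Suc j)) * PAV n A T"
  using assms(3)
proof (induction j)
  case 0
  have "PAV n A T \<le> PAV n A (remaining R n C A (Suc 0))"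
    using PAV_remove_min_loss_ge_subset[OF assms(1) _ assms(4)]
      remaining_step(3)[OF assms(1,2), of 0] 0 by simp
  \<comment> \<open>Both factors are \<open>card C - 1\<close> here.\<close>
  then show ?case
    using 0 by (intro mult_mono) (auto simp: PAV_nonneg)
next
  case (Suc j)
  let ?m = "real (card C)" and ?s = "real (card C) - real (Suc j)"
  let ?P = "\<lambda>j. PAV n A (remaining R n C A j)"
  have j: "Suc j < card C" using Suc.prems by simp
  note step = remaining_step[OF assms(1,2) j, of n A]
  have "real (card (remaining R n C A (Suc j))) = ?s"
    using step(2) j by (simp add: of_nat_diff)
  then have loss: "(?s - 1) * ?P (Suc j) \<le> ?s * ?P (Suc (Suc j))"
    using PAV_remove_min_loss_ge[OF finite_subset[OF step(1) assms(1)] step(3)] by simp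
  have s: "?s > 0" "?s - 1 \<ge> 0" and m: "?m - 1 \<ge> 0" using Suc.prems by auto
  \<comment> \<open>The goal is scaled by \<open>?s\<close>, so that the induction hypothesis and
    \<open>loss\<close> can be chained; the positive factor \<open>?s\<close> is cancelled at the
    end.\<close>
  have "?s * ((?s - 1) * PAV n A T) = (?s - 1) * (?s * PAV n A T)"
    by (simp only: mult.left_commute)
  also have "\<dots> \<le> (?s - 1) * ((?m - 1) * ?P (Suc j))"
    using Suc.IH[OF j] s(2) by (rule mult_left_mono)
  also have "\<dots> = (?m - 1) * ((?s - 1) * ?P (Suc j))"
    by (simp only: mult.left_commute)
  also have "\<dots> \<le> (?m - 1) * (?s * ?P (Suc (Suc j)))"
    using loss m by (rule mult_left_mono)
  also have "\<dots> = ?s * ((?m - 1) * ?P (Suc (Suc j)))"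
    by (simp only: mult.left_commute)
  finally have "(?s - 1) * PAV n A T \<le> (?m - 1) * ?P (Suc (Suc j))"
    using s(1) by (rule mult_left_le_imp_le)
  moreover have "?s - 1 = ?m - real (Suc (Suc j))" by simp
  ultimately show ?case by (simp only:)
qed

lemma OPT_attained:
  assumes "finite C" "k \<le> card C"
  obtains T where "T \<subseteq> C" "card T = k" "OPT n C A k = PAV n A T"
proof -
  have "committees C k \<subseteq> Pow C" by (auto simp: committees_def)
  then have "finite (committees C k)" using assms(1) by (simp add: finite_subset)
  moreover have "committees C k \<noteq> {}"
    using obtain_subset_with_card_n[OF assms(2)] by (auto simp: committees_def)
  ultimately have "OPT n C A k \<in> PAV n A ` committees C k"
    unfolding OPT_def by (intro Max_in) auto
  then show ?thesis using that by (auto simp: committees_def)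
qed

theorem theorem8:
  fixes n k m r :: nat and C W :: "'c set" and A :: "nat \<Rightarrow> 'c set" and R :: "('c \<times> 'c) set"
  assumes "election n C A k"
    and "linear_order_on C R"
    and "m = card C"
    and "r = m - k"
    and "W = reverse_seq_PAV R n C A k"
  shows "PAV n A W \<ge> real k / (real m - 1) * OPT n C A k
    \<and> real k / (real m - 1) * OPT n C A k = real k / (real k + real r - 1) * OPT n C A k"
proof
  interpret election n C A k by fact
  obtain T where T: "T \<subseteq> C" "card T = k" "OPT n C A k = PAV n A T"
    using OPT_attained[OF finite_candidates] k_less by (metis less_imp_le)
  have "T \<subset> C" using T k_less by auto
  \<comment> \<open>\<open>k < card C\<close> forces at least one removal, and
    \<open>1 \<le> k\<close> leaves at least one candidate, as \<open>PAV_remaining_ge\<close>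
    requires.\<close>
  obtain j where j: "card C - k = Suc j"
    using k_less by (metis Suc_diff_Suc)
  have "Suc j < card C" using j k_pos k_less by simp
  from PAV_remaining_ge[OF finite_candidates assms(2) this \<open>T \<subset> C\<close>, of n A]
  have "real k * OPT n C A k \<le> (real m - 1) * PAV n A W"
    using k_less T(3) by (simp add: assms(3,5) reverse_seq_PAV_def j[symmetric] of_nat_diff
        del: remaining.simps)
  moreover have "real m - 1 > 0" using k_pos k_less assms(3) by simp
  ultimately show "PAV n A W \<ge> real k / (real m - 1) * OPT n C A k"
    by (simp add: field_simps)
  show "real k / (real m - 1) * OPT n C A k = real k / (real k + real r - 1) * OPT n C A k"
    using k_less by (simp add: assms(3,4) of_nat_diff)
qed

end
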